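(* Let $(X,d)$ be a separable metric space, $T\colon X\to X$ a Borel measurable map, and $\mu,\nu$ two $T$-invariant $T$-ergodic Borel probability measures on $X$. Assume $T$ is locally Lipschitz mod $\nu$ and $(s_n)_{n\ge1}$ is a nice scale sequence. Then $\phi(x,y)=\liminf_{n\to\infty}s_n\,d(T^nx,y)$ satisfies either $\phi=0$ for $\mu\times\nu$-a.e. $(x,y)$, or $\phi=\infty$ for $\mu\times\nu$-a.e. $(x,y)$.
   Context: A scale sequence is a sequence of positive reals $s_n\to\infty$. It is nice if $s_{n+1}\ge s_n$ for large $n$, $\liminf_n s_{2n}/s_n>1$, and $\sup_n s_{n+1}/s_n<\infty$. The dilation gauge is $D_T(x)=\limsup_{y\to x} d(Ty,Tx)/d(y,x)$ if $x$ is a limit point of $X$ and $0$ if $x$ is isolated; $T$ is locally Lipschitz mod $\nu$ if $D_T<\infty$ $\nu$-a.e. *)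

theory Defs
  imports "HOL-Probability.Probability"
begin

definition invariant_prob :: "('a::topological_space \<Rightarrow> 'a) \<Rightarrow> 'a measure \<Rightarrow> bool" where
  "invariant_prob T M \<longleftrightarrow> prob_space M \<and> sets M = sets borel \<and>
     T \<in> borel_measurable borel \<and> distr M borel T = M"

definition ergodic :: "('a::topological_space \<Rightarrow> 'a) \<Rightarrow> 'a measure \<Rightarrow> bool" where
  "ergodic T M \<longleftrightarrow> (\<forall>A \<in> sets borel. T -` A = A \<longrightarrow> measure M A = 0 \<or> measure M A = 1)"

definition dilation_gauge :: "('a::metric_space \<Rightarrow> 'a) \<Rightarrow> 'a \<Rightarrow> ereal" where
  "dilation_gauge T x =
     (if x islimpt UNIV then Limsup (at x) (\<lambda>y. ereal (dist (T y) (T x) / dist y x)) else 0)"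

definition locally_lipschitz_mod :: "('a::metric_space \<Rightarrow> 'a) \<Rightarrow> 'a measure \<Rightarrow> bool" where
  "locally_lipschitz_mod T M \<longleftrightarrow> (AE x in M. dilation_gauge T x < \<infinity>)"

text \<open>Nice scale sequence, indexed by n \<ge> 1 (the value s 0 is irrelevant).\<close>
definition nice_scale :: "(nat \<Rightarrow> real) \<Rightarrow> bool" where
  "nice_scale s \<longleftrightarrow>
     (\<forall>n\<ge>1. s n > 0) \<and> filterlim s at_top sequentially \<and>
     (\<forall>\<^sub>F n in sequentially. s (Suc n) \<ge> s n) \<and>
     liminf (\<lambda>n. ereal (s (2 * n) / s n)) > 1 \<and>
     (\<exists>C. \<forall>n\<ge>1. s (Suc n) / s n \<le> C)"

end

theory Submission
  imports Defs
begin

text \<open>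
  Fix \<open>y\<close>. As \<open>s\<close> is eventually nondecreasing, \<open>\<phi>(\<cdot>, y)\<close> does not increase along
  \<open>T\<close>-orbits, so by ergodicity it is \<open>\<mu>\<close>-a.e. equal to a constant \<open>g\<close>. Suppose \<open>0 < g < \<infinity>\<close>, and
  choose \<open>a < g < b\<close> with \<open>b < \<lambda> a\<close>, where \<open>s (2 n) \<ge> \<lambda> s n\<close> for large \<open>n\<close>. The set of points \<open>z\<close> having
  \<open>s m d(T\<^sup>m z, y) < a\<close> for some \<open>m \<ge> N\<close> has small measure if \<open>N\<close> is large. On the other hand, almost
  every \<open>x\<close> has \<open>s n d(T\<^sup>n x, y) < b\<close> for infinitely many \<open>n\<close>, and then \<open>T\<^sup>i x\<close> is in that set for
  all \<open>i\<close> between \<open>n / 2\<close> and \<open>n - N\<close>, a positive proportion of the times up to \<open>n\<close>: this contradicts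
  the maximal ergodic theorem. So for every \<open>y\<close> either \<open>\<phi>(\<cdot>, y) = 0\<close> or \<open>\<phi>(\<cdot>, y) = \<infinity>\<close> almost
  everywhere. Finally \<open>\<phi>(x, y) = 0\<close> implies \<open>\<phi>(x, T y) = 0\<close> wherever the dilation gauge
  is finite, and ergodicity of \<open>\<nu>\<close> decides between the two alternatives.
\<close>

section \<open>Invariant and ergodic measures\<close>

lemma invariant_probD:
  assumes "invariant_prob T M"
  shows "prob_space M" "sets M = sets borel" "T \<in> measurable M M" "distr M M T = M" "space M = UNIV"
proof -
  show "prob_space M" and s: "sets M = sets borel" using assms by (auto simp: invariant_prob_def)
  show "T \<in> measurable M M"
    using assms measurable_cong_sets[OF s s] by (auto simp: invariant_prob_def)
  show "distr M M T = M" using assms distr_cong[OF refl s, of M T T]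
    by (simp add: invariant_prob_def)
  show "space M = UNIV" using sets_eq_imp_space_eq[OF s] by simp
qed

lemma funpow_measurable:
  assumes "T \<in> measurable M M"
  shows "(T ^^ n) \<in> measurable M M"
  using assms by (rule measurable_compose_n)

lemma AE_invariant_compose:
  assumes inv: "invariant_prob T M" and P: "AE x in M. P x"
  shows "AE x in M. P (T x)"
  by (rule AE_distrD[OF invariant_probD(3)[OF inv]]) (subst invariant_probD(4)[OF inv], rule P)

lemma AE_invariant_funpow:
  assumes inv: "invariant_prob T M" and P: "AE x in M. P x"
  shows "AE x in M. P ((T ^^ n) x)"
proof (induction n)
  case (Suc n)
  then show ?case using AE_invariant_compose[OF inv, of "\<lambda>x. P ((T ^^ n) x)"]
    by (simp add: funpow_swap1)
qed (use P in simp)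

lemma integral_invariant_compose:
  fixes f :: "'a::topological_space \<Rightarrow> real"
  assumes inv: "invariant_prob T M" and f: "integrable M f"
  shows "integrable M (\<lambda>x. f (T x))" "(\<integral>x. f (T x) \<partial>M) = (\<integral>x. f x \<partial>M)"
proof -
  note T = invariant_probD(3,4)[OF inv]
  have "f \<in> borel_measurable M" using f by simp
  from integrable_distr_eq[OF T(1) this] integral_distr[OF T(1) this] T(2) f
  show "integrable M (\<lambda>x. f (T x))" "(\<integral>x. f (T x) \<partial>M) = (\<integral>x. f x \<partial>M)" by auto
qed

lemma AE_reverse_subinvariant:
  assumes inv: "invariant_prob T M" and A: "A \<in> sets M"
    and sub: "AE x in M. x \<in> A \<longrightarrow> T x \<in> A"
  shows "AE x in M. T x \<in> A \<longrightarrow> x \<in> A"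
proof -
  interpret prob_space M by (rule invariant_probD(1)[OF inv])
  note T = invariant_probD(3,4)[OF inv]
  have sp: "space M = UNIV" by (rule invariant_probD(5)[OF inv])
  have TA: "T -` A \<in> sets M" using measurable_sets[OF T(1) A] sp by simp
  have "measure M (T -` A) = measure M A"
    using measure_distr[OF T(1) A] T(2) sp by simp
  moreover have "measure M (A \<inter> T -` A) = measure M A"
    by (rule finite_measure_eq_AE) (use sub A TA in auto)
  moreover have "measure M (T -` A - A) = measure M (T -` A) - measure M (T -` A \<inter> A)"
    by (rule finite_measure_Diff') (use A TA in auto)
  ultimately have "measure M (T -` A - A) = 0" by (simp add: Int_commute)
  then have "T -` A - A \<in> null_sets M" using A TA by (auto simp: emeasure_eq_measure)
  from AE_not_in[OF this] show ?thesis by eventually_elim auto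
qed

text \<open>The notion \<^const>\<open>ergodic\<close> speaks of strictly invariant sets only; the set of points whose
  orbit visits \<open>A\<close> infinitely often is strictly invariant and agrees with \<open>A\<close> up to a null set.\<close>

lemma ergodic_subinvariant:
  assumes inv: "invariant_prob T M" and erg: "ergodic T M" and A: "A \<in> sets M"
    and sub: "AE x in M. x \<in> A \<longrightarrow> T x \<in> A"
  shows "(AE x in M. x \<in> A) \<or> (AE x in M. x \<notin> A)"
proof -
  interpret prob_space M by (rule invariant_probD(1)[OF inv])
  have sp: "space M = UNIV" by (rule invariant_probD(5)[OF inv])
  have sb: "sets M = sets borel" by (rule invariant_probD(2)[OF inv])
  have Tn [measurable]: "(T ^^ n) \<in> measurable M M" for n
    by (rule funpow_measurable[OF invariant_probD(3)[OF inv]])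
  note [measurable] = A
  define B where "B = {x. \<forall>n. \<exists>m\<ge>n. (T ^^ m) x \<in> A}"
  have "{x \<in> space M. \<forall>n. \<exists>m\<ge>n. (T ^^ m) x \<in> A} \<in> sets M" by measurable
  then have B: "B \<in> sets M" by (simp add: B_def sp)
  have "T x \<in> B \<longleftrightarrow> x \<in> B" for x
  proof -
    have B: "z \<in> B \<longleftrightarrow> \<not> (\<forall>\<^sub>F m in sequentially. (T ^^ m) z \<notin> A)" for z
      by (simp add: B_def eventually_sequentially)
    \<comment> \<open>Visiting \<open>A\<close> infinitely often is unaffected by shifting time by
      one, so \<open>B\<close> is invariant exactly and not only almost everywhere.\<close>
    show ?thesis
      using eventually_sequentially_Suc[of "\<lambda>m. (T ^^ m) x \<notin> A"]
      by (simp add: B funpow_swap1)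
  qed
  then have "T -` B = B" by auto
  with erg B sb have "measure M B = 0 \<or> measure M B = 1" by (auto simp: ergodic_def)
  then have *: "(AE x in M. x \<in> B) \<or> (AE x in M. x \<notin> B)"
  proof
    assume "measure M B = 0"
    then have "B \<in> null_sets M" using B by (auto simp: emeasure_eq_measure)
    then show ?thesis using AE_not_in by blast
  next
    assume "measure M B = 1"
    then show ?thesis using prob_eq_1[OF B] by blast
  qed
  have "AE x in M. T x \<in> A \<longleftrightarrow> x \<in> A"
    using sub AE_reverse_subinvariant[OF inv A sub] by eventually_elim auto
  from AE_invariant_funpow[OF inv this]
  have "AE x in M. \<forall>n. (T ^^ Suc n) x \<in> A \<longleftrightarrow> (T ^^ n) x \<in> A"
    by (subst AE_all_countable) simp
  then have "AE x in M. x \<in> B \<longleftrightarrow> x \<in> A"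
  proof eventually_elim
    case (elim x)
    have "(T ^^ n) x \<in> A \<longleftrightarrow> x \<in> A" for n
      by (induction n) (use elim in auto)
    then show ?case by (auto simp: B_def)
  qed
  then have "(AE x in M. x \<in> B) = (AE x in M. x \<in> A)" "(AE x in M. x \<notin> B) = (AE x in M. x \<notin> A)"
    by (auto elim!: eventually_elim2)
  with * show ?thesis by simp
qed

section \<open>The maximal ergodic theorem\<close>

text \<open>The maximum of the partial sums \<open>f x + f (T x) + \<dots> + f (T\<^sup>k\<^sup>-\<^sup>1 x)\<close> over \<open>0 \<le> k \<le> n\<close>, in the
  recursive form in which it is compared with itself along \<open>T\<close>.\<close>

fun max_orbit_sum :: "('a \<Rightarrow> 'a) \<Rightarrow> ('a \<Rightarrow> real) \<Rightarrow> nat \<Rightarrow> 'a \<Rightarrow> real" where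
  "max_orbit_sum T f 0 x = 0"
| "max_orbit_sum T f (Suc n) x = max 0 (f x + max_orbit_sum T f n (T x))"

lemma max_orbit_sum_nonneg: "0 \<le> max_orbit_sum T f n x"
  by (cases n) auto

lemma max_orbit_sum_mono_Suc: "max_orbit_sum T f n x \<le> max_orbit_sum T f (Suc n) x"
  by (induction n arbitrary: x) (auto simp: max.coboundedI2 intro!: max.mono)

lemma sum_le_max_orbit_sum: "(\<Sum>i<n. f ((T ^^ i) x)) \<le> max_orbit_sum T f n x"
proof (induction n arbitrary: x)
  case (Suc n)
  have "(\<Sum>i<Suc n. f ((T ^^ i) x)) = f x + (\<Sum>i<n. f ((T ^^ i) (T x)))"
    by (subst sum.lessThan_Suc_shift) (simp add: funpow_swap1)
  with Suc[of "T x"] show ?case by simp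
qed simp

lemma integrable_max_orbit_sum:
  fixes f :: "'a::topological_space \<Rightarrow> real"
  assumes inv: "invariant_prob T M" and f: "integrable M f"
  shows "integrable M (max_orbit_sum T f n)"
proof (induction n)
  case 0
  have "max_orbit_sum T f 0 = (\<lambda>x. 0)" by auto
  then show ?case by simp
next
  case (Suc n)
  have "max_orbit_sum T f (Suc n) = (\<lambda>x. max 0 (f x + max_orbit_sum T f n (T x)))" by auto
  then show ?case using f integral_invariant_compose(1)[OF inv Suc] by simp
qed

text \<open>Garsia's argument: where the maximum \<open>?m\<close> is positive, \<open>?m x\<close>
  is at most \<open>f x + ?m (T x)\<close>; elsewhere it is 0, hence at most
  \<open>?m (T x)\<close>. The difference of \<open>?m\<close> and its composition with
  \<open>T\<close> has integral 0 by invariance.\<close>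

lemma maximal_ergodic:
  fixes f :: "'a::topological_space \<Rightarrow> real"
  assumes inv: "invariant_prob T M" and f: "integrable M f"
  shows "0 \<le> (\<integral>x. f x * indicator {x. max_orbit_sum T f n x > 0} x \<partial>M)"
proof (cases n)
  case (Suc k)
  let ?m = "max_orbit_sum T f n"
  have sp: "space M = UNIV" by (rule invariant_probD(5)[OF inv])
  have m: "integrable M ?m" by (rule integrable_max_orbit_sum[OF inv f])
  have m': "integrable M (\<lambda>x. ?m (T x))"
    and eq: "(\<integral>x. ?m (T x) \<partial>M) = (\<integral>x. ?m x \<partial>M)"
    using integral_invariant_compose[OF inv m] by auto
  have "?m \<in> borel_measurable M" using m by simp
  then have S: "{x. ?m x > 0} \<in> sets M"
    using borel_measurable_less[of "\<lambda>_. 0" M ?m] sp by simp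
  have "(\<integral>x. ?m x - ?m (T x) \<partial>M) \<le> (\<integral>x. f x * indicator {x. ?m x > 0} x \<partial>M)"
  proof (rule integral_mono)
    show "integrable M (\<lambda>x. f x * indicator {x. ?m x > 0} x)"
      by (rule integrable_real_mult_indicator[OF S f])
    show "integrable M (\<lambda>x. ?m x - ?m (T x))" using m m' by simp
    fix x
    show "?m x - ?m (T x) \<le> f x * indicator {x. ?m x > 0} x"
    proof (cases "?m x > 0")
      case True
      then have "?m x = f x + max_orbit_sum T f k (T x)" using Suc by auto
      moreover have "max_orbit_sum T f k (T x) \<le> ?m (T x)"
        unfolding Suc by (rule max_orbit_sum_mono_Suc)
      ultimately show ?thesis using True by simp
    next
      case False
      then show ?thesis using max_orbit_sum_nonneg[of T f n "T x"] by simp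
    qed
  qed
  then show ?thesis using eq m m' by simp
qed simp

text \<open>The maximal inequality is applied to \<open>indicator B - c\<close>. The time
  \<open>n\<close> may depend on \<open>x\<close>: the sets \<open>E n\<close> increase to a set of
  full measure, and the bound passes to the limit.\<close>

lemma maximal_ergodic_frequency:
  assumes inv: "invariant_prob T M" and B: "B \<in> sets M"
    and freq: "AE x in M. \<exists>n. c * real n < (\<Sum>i<n. indicator B ((T ^^ i) x))"
  shows "c \<le> measure M B"
proof (cases "0 \<le> c")
  case c: True
  interpret prob_space M by (rule invariant_probD(1)[OF inv])
  have sp: "space M = UNIV" by (rule invariant_probD(5)[OF inv])
  define f where "f x = indicator B x - c" for x
  have f: "integrable M f" unfolding f_def using B by (simp add: emeasure_eq_measure)
  define E where "E n = {x. max_orbit_sum T f n x > 0}" for n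
  have E: "E n \<in> sets M" for n
  proof -
    have "max_orbit_sum T f n \<in> borel_measurable M"
      using integrable_max_orbit_sum[OF inv f] by simp
    then show ?thesis
      using borel_measurable_less[of "\<lambda>_. 0" M "max_orbit_sum T f n"] sp by (simp add: E_def)
  qed
  have "incseq E"
  proof (rule incseq_SucI, rule subsetI)
    fix n x assume "x \<in> E n"
    then show "x \<in> E (Suc n)"
      using max_orbit_sum_mono_Suc[of T f n x] unfolding E_def mem_Collect_eq by linarith
  qed
  then have "(\<lambda>n. measure M (E n)) \<longlonglongrightarrow> measure M (\<Union>n. E n)"
    by (intro finite_Lim_measure_incseq) (use E in auto)
  moreover have "measure M (\<Union>n. E n) = 1"
  proof -
    have "AE x in M. x \<in> (\<Union>n. E n)"
      using freq
    proof eventually_elim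
      case (elim x)
      then obtain n where "c * real n < (\<Sum>i<n. indicator B ((T ^^ i) x))" by blast
      then have "0 < (\<Sum>i<n. f ((T ^^ i) x))" by (simp add: f_def sum_subtractf mult.commute)
      then have "x \<in> E n" using sum_le_max_orbit_sum[of f T x n] by (simp add: E_def)
      then show ?case by blast
    qed
    then show ?thesis using prob_eq_1[of "\<Union>n. E n"] E by blast
  qed
  ultimately have lim: "(\<lambda>n. c * measure M (E n)) \<longlonglongrightarrow> c * 1"
    by (intro tendsto_mult tendsto_const) simp
  have "c * measure M (E n) \<le> measure M B" for n
  proof -
    have "0 \<le> (\<integral>x. f x * indicator (E n) x \<partial>M)"
      unfolding E_def by (rule maximal_ergodic[OF inv f])
    also have "\<dots> \<le> (\<integral>x. indicator B x - c * indicator (E n) x \<partial>M)"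
    proof (rule integral_mono)
      show "integrable M (\<lambda>x. f x * indicator (E n) x)"
        by (rule integrable_real_mult_indicator[OF E f])
      show "integrable M (\<lambda>x. indicator B x - c * indicator (E n) x)"
        using B E[of n] by (simp add: emeasure_eq_measure)
    qed (auto simp: f_def indicator_def)
    also have "\<dots> = measure M B - c * measure M (E n)"
      using B E[of n] sp by (simp add: emeasure_eq_measure)
    finally show ?thesis by simp
  qed
  with lim show ?thesis using LIMSEQ_le_const2 by force
qed (use measure_nonneg[of M B] in linarith)

section \<open>The scaled distance to an orbit\<close>

definition scaled_liminf :: "('a::metric_space \<Rightarrow> 'a) \<Rightarrow> (nat \<Rightarrow> real) \<Rightarrow> 'a \<Rightarrow> 'a \<Rightarrow> ereal" where
  "scaled_liminf T s x y = liminf (\<lambda>n. ereal (s n * dist ((T ^^ n) x) y))"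

lemma frequently_of_scaled_liminf_less:
  assumes "scaled_liminf T s x y < ereal b"
  shows "\<exists>\<^sub>F n in sequentially. s n * dist ((T ^^ n) x) y < b"
proof (rule ccontr)
  assume "\<not> ?thesis"
  then have "\<forall>\<^sub>F n in sequentially. ereal b \<le> ereal (s n * dist ((T ^^ n) x) y)"
    by (simp add: frequently_def not_less)
  then have "ereal b \<le> scaled_liminf T s x y"
    unfolding scaled_liminf_def by (rule Liminf_bounded)
  with assms show False by simp
qed

lemma scaled_liminf_le_of_frequently:
  assumes "\<exists>\<^sub>F n in sequentially. s n * dist ((T ^^ n) x) y \<le> b"
  shows "scaled_liminf T s x y \<le> ereal b"
proof (rule ccontr)
  assume "\<not> ?thesis"
  then have "ereal b < liminf (\<lambda>n. ereal (s n * dist ((T ^^ n) x) y))"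
    by (simp add: scaled_liminf_def not_le)
  from less_LiminfD[OF this] have "\<forall>\<^sub>F n in sequentially. \<not> s n * dist ((T ^^ n) x) y \<le> b"
    by eventually_elim simp
  with assms show False by (simp add: frequently_def)
qed

lemma nice_scale_pos:
  assumes "nice_scale s"
  shows "\<forall>\<^sub>F n in sequentially. 0 < s n"
  using assms by (auto simp: nice_scale_def eventually_sequentially)

lemma nice_scale_doubling:
  assumes "nice_scale s"
  obtains l where "l > 1" "\<forall>\<^sub>F n in sequentially. l * s n \<le> s (2 * n)"
proof -
  have "1 < liminf (\<lambda>n. ereal (s (2 * n) / s n))" using assms by (simp add: nice_scale_def)
  then obtain l where l: "1 < ereal l" "ereal l < liminf (\<lambda>n. ereal (s (2 * n) / s n))"
    using ereal_dense2 by blast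
  have "\<forall>\<^sub>F n in sequentially. l * s n \<le> s (2 * n)"
    using less_LiminfD[OF l(2)] nice_scale_pos[OF assms]
    by eventually_elim (simp add: field_simps)
  with l(1) that show ?thesis by simp
qed

lemma scaled_liminf_nonneg:
  assumes "nice_scale s"
  shows "0 \<le> scaled_liminf T s x y"
  unfolding scaled_liminf_def
  by (rule Liminf_bounded) (use nice_scale_pos[OF assms] in eventually_elim, simp)

lemma scaled_liminf_orbit_le:
  assumes "nice_scale s"
  shows "scaled_liminf T s (T x) y \<le> scaled_liminf T s x y"
proof -
  have "\<forall>\<^sub>F n in sequentially. s n \<le> s (Suc n)" using assms by (simp add: nice_scale_def)
  then have "liminf (\<lambda>n. ereal (s n * dist ((T ^^ n) (T x)) y))
     \<le> liminf (\<lambda>n. ereal (s (Suc n) * dist ((T ^^ Suc n) x) y))"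
    by (intro Liminf_mono, eventually_elim) (simp add: funpow_swap1 mult_right_mono)
  also have "\<dots> = liminf (\<lambda>n. ereal (s n * dist ((T ^^ n) x) y))"
    using liminf_shift[of "\<lambda>n. ereal (s n * dist ((T ^^ n) x) y)"] by simp
  finally show ?thesis by (simp add: scaled_liminf_def)
qed

section \<open>Moving the target from \<open>y\<close> to \<open>T y\<close>\<close>

lemma dilation_gauge_local_bound:
  fixes y :: "'a::metric_space"
  assumes "dilation_gauge T y < \<infinity>"
  obtains K r where "r > 0" "K \<ge> 0" "\<And>z. dist z y < r \<Longrightarrow> dist (T z) (T y) \<le> K * dist z y"
proof (cases "y islimpt UNIV")
  case True
  then have "Limsup (at y) (\<lambda>z. ereal (dist (T z) (T y) / dist z y)) < \<infinity>"
    using assms by (simp add: dilation_gauge_def)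
  then obtain k where "Limsup (at y) (\<lambda>z. ereal (dist (T z) (T y) / dist z y)) < ereal k"
    using less_PInf_Ex_of_nat by force
  from Limsup_lessD[OF this]
  obtain r where r: "r > 0" "\<And>z. z \<noteq> y \<Longrightarrow> dist z y < r \<Longrightarrow> dist (T z) (T y) / dist z y < k"
    by (auto simp: eventually_at)
  have "dist (T z) (T y) \<le> max k 0 * dist z y" if "dist z y < r" for z
  proof (cases "z = y")
    case False
    then have "dist (T z) (T y) \<le> k * dist z y" using r(2)[OF False that] by (simp add: field_simps)
    also have "\<dots> \<le> max k 0 * dist z y" by (intro mult_right_mono) auto
    finally show ?thesis .
  qed simp
  with r(1) show ?thesis by (intro that[of r "max k 0"]) auto
next
  \<comment> \<open>Around an isolated point a small ball contains only \<open>y\<close>, so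
    \<open>K = 0\<close> works.\<close>
  case False
  then obtain r where r: "r > 0" "\<And>z. dist z y < r \<Longrightarrow> z = y"
    by (force simp: islimpt_approachable)
  show ?thesis
  proof (rule that[of r 0])
    fix z assume "dist z y < r"
    then have "z = y" by (rule r(2))
    then show "dist (T z) (T y) \<le> 0 * dist z y" by simp
  qed (use r in auto)
qed

text \<open>At a large time \<open>n\<close> with \<open>s n * dist ((T ^^ n) x) y\<close> small,
  the point \<open>(T ^^ n) x\<close> is in the ball where \<open>T\<close> is Lipschitz at
  \<open>y\<close>. One more step multiplies the distance by at most \<open>K\<close> and the scale
  by at most \<open>C\<close>.\<close>

lemma scaled_liminf_zero_image:
  assumes s: "nice_scale s" and D: "dilation_gauge T y < \<infinity>"
    and zero: "scaled_liminf T s x y = 0"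
  shows "scaled_liminf T s x (T y) = 0"
proof -
  obtain K r where K: "r > 0" "K \<ge> 0" "\<And>z. dist z y < r \<Longrightarrow> dist (T z) (T y) \<le> K * dist z y"
    using dilation_gauge_local_bound[OF D] by blast
  obtain C where C: "\<And>n. n \<ge> 1 \<Longrightarrow> s (Suc n) / s n \<le> C" using s by (auto simp: nice_scale_def)
  \<comment> \<open>\<open>max C 1\<close> and \<open>K + 1\<close> replace \<open>C\<close> and
    \<open>K\<close> so that division by \<open>L\<close> is possible.\<close>
  define L where "L = max C 1 * (K + 1)"
  have L: "L > 0" using K(2) by (simp add: L_def)
  have "scaled_liminf T s x (T y) \<le> ereal e" if e: "e > 0" for e
  proof (rule scaled_liminf_le_of_frequently)
    have "\<exists>\<^sub>F n in sequentially. s n * dist ((T ^^ n) x) y < e / L"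
      by (rule frequently_of_scaled_liminf_less) (use zero e L in simp)
    \<comment> \<open>This size of \<open>s n\<close> turns \<open>s n * ?d < e / L\<close> into
      \<open>?d < r\<close> below.\<close>
    moreover have "\<forall>\<^sub>F n in sequentially. e / L / r < s n"
      using s by (auto simp: nice_scale_def filterlim_at_top_dense)
    then have "\<forall>\<^sub>F n in sequentially. e / L / r < s n \<and> 0 < s n \<and> n \<ge> 1"
      using nice_scale_pos[OF s] eventually_ge_at_top[of 1] by eventually_elim simp
    ultimately have "\<exists>\<^sub>F n in sequentially.
        s n * dist ((T ^^ n) x) y < e / L \<and> e / L / r < s n \<and> 0 < s n \<and> n \<ge> 1"
      by (rule frequently_eventually_frequently)
    then have "\<exists>\<^sub>F n in sequentially. s (Suc n) * dist ((T ^^ Suc n) x) (T y) \<le> e"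
    proof (rule frequently_elim1)
      fix n
      let ?d = "dist ((T ^^ n) x) y"
      assume *: "s n * ?d < e / L \<and> e / L / r < s n \<and> 0 < s n \<and> n \<ge> 1"
      have "e / L < s n * r" using * K(1) by (metis pos_divide_less_eq)
      with * have "s n * ?d < s n * r" by linarith
      then have d: "?d < r" using * by simp
      have "s (Suc n) \<le> C * s n" using C[of n] * by (simp add: pos_divide_le_eq)
      also have "\<dots> \<le> max C 1 * s n" using * by (intro mult_right_mono) auto
      finally have "s (Suc n) * dist ((T ^^ Suc n) x) (T y) \<le> (max C 1 * s n) * ((K + 1) * ?d)"
      proof (rule mult_mono)
        have "dist ((T ^^ Suc n) x) (T y) \<le> K * ?d" using K(3)[OF d] by simp
        also have "\<dots> \<le> (K + 1) * ?d" by (intro mult_right_mono) auto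
        finally show "dist ((T ^^ Suc n) x) (T y) \<le> (K + 1) * ?d" .
      qed (use * in auto)
      also have "\<dots> = L * (s n * ?d)" by (simp add: L_def)
      also have "\<dots> \<le> e" using * L by (simp add: field_simps)
      finally show "s (Suc n) * dist ((T ^^ Suc n) x) (T y) \<le> e" .
    qed
    then show "\<exists>\<^sub>F n in sequentially. s n * dist ((T ^^ n) x) (T y) \<le> e"
      unfolding frequently_def
      using eventually_sequentially_Suc[of "\<lambda>n. \<not> s n * dist ((T ^^ n) x) (T y) \<le> e"] by simp
  qed
  then have "scaled_liminf T s x (T y) \<le> 0"
    by (metis ereal_le_epsilon2 add_0 zero_ereal_def)
  with scaled_liminf_nonneg[OF s] show ?thesis by (metis order_antisym)
qed

section \<open>Measurability and almost everywhere constancy\<close>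

lemma scaled_liminf_pair_measurable:
  fixes T :: "'a::{metric_space, second_countable_topology} \<Rightarrow> 'a"
  assumes T: "T \<in> borel_measurable borel"
    and M: "sets M = sets borel" and N: "sets N = sets borel"
  shows "(\<lambda>p. scaled_liminf T s (fst p) (snd p)) \<in> borel_measurable (M \<Otimes>\<^sub>M N)"
proof -
  have Tn [measurable]: "(T ^^ n) \<in> borel_measurable borel" for n
    by (rule funpow_measurable[OF T])
  \<comment> \<open>Second countability makes \<open>dist\<close> measurable for the product of the
    two Borel sigma-algebras.\<close>
  have "(\<lambda>p::'a \<times> 'a. liminf (\<lambda>n. ereal (s n * dist ((T ^^ n) (fst p)) (snd p))))
      \<in> borel_measurable (borel \<Otimes>\<^sub>M borel)"
    by measurable
  then show ?thesis
    unfolding scaled_liminf_def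
    using measurable_cong_sets[OF sets_pair_measure_cong[OF M N] refl] by blast
qed

lemma scaled_liminf_measurable:
  fixes T :: "'a::{metric_space, second_countable_topology} \<Rightarrow> 'a"
  assumes inv: "invariant_prob T M"
  shows "(\<lambda>x. scaled_liminf T s x y) \<in> borel_measurable M"
proof -
  have Tn [measurable]: "(T ^^ n) \<in> borel_measurable M" for n
    using funpow_measurable[OF invariant_probD(3)[OF inv]]
      measurable_cong_sets[OF refl invariant_probD(2)[OF inv]] by blast
  show ?thesis unfolding scaled_liminf_def by measurable
qed

text \<open>The function does not increase along orbits, so every sublevel set is forward invariant
  and, by ergodicity, null or of full measure. The constant is the essential supremum.\<close>

lemma scaled_liminf_ae_constant:
  fixes T :: "'a::{metric_space, second_countable_topology} \<Rightarrow> 'a"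
  assumes inv: "invariant_prob T M" and erg: "ergodic T M" and s: "nice_scale s"
  obtains g where "AE x in M. scaled_liminf T s x y = g" "0 \<le> g"
proof -
  interpret prob_space M by (rule invariant_probD(1)[OF inv])
  let ?f = "\<lambda>x. scaled_liminf T s x y"
  have sp: "space M = UNIV" by (rule invariant_probD(5)[OF inv])
  have dich: "(AE x in M. ?f x \<le> c) \<or> (AE x in M. \<not> ?f x \<le> c)" for c
  proof -
    have level: "{x. ?f x \<le> c} \<in> sets M"
      using borel_measurable_le[OF scaled_liminf_measurable[OF inv] borel_measurable_const] sp by simp
    have "AE x in M. x \<in> {x. ?f x \<le> c} \<longrightarrow> T x \<in> {x. ?f x \<le> c}"
      by (rule AE_I2) (use scaled_liminf_orbit_le[OF s] in \<open>auto intro: order_trans\<close>)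
    from ergodic_subinvariant[OF inv erg level this] show ?thesis by simp
  qed
  define g where "g = Inf {c. AE x in M. ?f x \<le> c}"
  have "AE x in M. ?f x \<le> g"
  proof -
    have "\<infinity> \<in> {c. AE x in M. ?f x \<le> c}" by simp
    then have "{c. AE x in M. ?f x \<le> c} \<noteq> {}" by blast
    from Inf_countable_INF[OF this]
    obtain u :: "nat \<Rightarrow> ereal" where "range u \<subseteq> {c. AE x in M. ?f x \<le> c}" "g = Inf (range u)"
      unfolding g_def by blast
    then have u: "\<And>n. AE x in M. ?f x \<le> u n" "g = Inf (range u)" by auto
    have "AE x in M. \<forall>n. ?f x \<le> u n" using u(1) by (simp add: AE_all_countable)
    then show ?thesis unfolding u(2) by eventually_elim (auto intro: Inf_greatest)
  qed
  moreover have "AE x in M. g \<le> ?f x"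
  proof -
    \<comment> \<open>Rational levels suffice to approach \<open>g\<close> from below, and countably
      many exceptional null sets can be united.\<close>
    have "AE x in M. \<forall>q::rat. ereal (of_rat q) < g \<longrightarrow> ereal (of_rat q) \<le> ?f x"
    proof (subst AE_all_countable, intro allI)
      fix q :: rat
      show "AE x in M. ereal (of_rat q) < g \<longrightarrow> ereal (of_rat q) \<le> ?f x"
      proof (cases "ereal (of_rat q) < g")
        case True
        then have "\<not> (AE x in M. ?f x \<le> ereal (of_rat q))"
          unfolding g_def using Inf_lower[of "ereal (of_rat q)"] by (auto simp: not_le[symmetric])
        with dich[of "ereal (of_rat q)"] show ?thesis by (auto elim: eventually_mono)
      qed simp
    qed
    then show ?thesis
    proof eventually_elim
      case (elim x)
      show ?case
      proof (rule ccontr)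
        assume "\<not> g \<le> ?f x"
        then obtain r where "?f x < ereal (of_rat r)" "ereal (of_rat r) < g"
          using ereal_dense3 by (metis not_le)
        with elim show False by (metis not_le)
      qed
    qed
  qed
  ultimately have ae: "AE x in M. ?f x = g" by eventually_elim simp
  from ae have "AE x in M. 0 \<le> g"
    by (rule eventually_mono) (use scaled_liminf_nonneg[OF s] in blast)
  then have "0 \<le> g" by simp
  with ae that show ?thesis by blast
qed

section \<open>Zero-infinity law for a fixed target\<close>

lemma scaled_liminf_zero_or_infinite:
  fixes T :: "'a::{metric_space, second_countable_topology} \<Rightarrow> 'a"
  assumes inv: "invariant_prob T M" and erg: "ergodic T M" and s: "nice_scale s"
  shows "(AE x in M. scaled_liminf T s x y = 0) \<or> (AE x in M. scaled_liminf T s x y = \<infinity>)"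
proof -
  interpret prob_space M by (rule invariant_probD(1)[OF inv])
  have sp: "space M = UNIV" by (rule invariant_probD(5)[OF inv])
  obtain g' where g': "AE x in M. scaled_liminf T s x y = g'" "0 \<le> g'"
    using scaled_liminf_ae_constant[OF inv erg s] .
  consider "g' = 0" | "g' = \<infinity>" | g where "g' = ereal g" "g > 0"
    using g'(2) by (cases g') force+
  then show ?thesis
  proof cases
    case 3
    then have ae: "AE x in M. scaled_liminf T s x y = ereal g" using g' by simp
    obtain l where l: "l > 1" "\<forall>\<^sub>F n in sequentially. l * s n \<le> s (2 * n)"
      using nice_scale_doubling[OF s] .
    \<comment> \<open>As \<open>l > 1\<close>, the factor \<open>2 / (1 + l)\<close> is below 1
      while \<open>2 * l / (1 + l)\<close> is above 1, so \<open>g\<close> lies strictly between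
      \<open>a\<close> and \<open>l * a\<close>.\<close>
    define a where "a = 2 * g / (1 + l)"
    have ag: "a < g" and "g < l * a" using 3 l(1) by (auto simp: a_def field_simps)
    then obtain b where b: "g < b" "b < l * a" using dense by blast
    have "\<forall>\<^sub>F n in sequentially. s n \<le> s (Suc n)" using s by (simp add: nice_scale_def)
    then have "\<forall>\<^sub>F n in sequentially. s n \<le> s (Suc n) \<and> l * s n \<le> s (2 * n) \<and> 0 < s n"
      using l(2) nice_scale_pos[OF s] by eventually_elim simp
    then obtain N0 where N0: "\<And>n. n \<ge> N0 \<Longrightarrow> s n \<le> s (Suc n)"
        "\<And>n. n \<ge> N0 \<Longrightarrow> l * s n \<le> s (2 * n)" "\<And>n. n \<ge> N0 \<Longrightarrow> 0 < s n"
      by (auto simp: eventually_sequentially)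
    have mono: "s m \<le> s n" if "N0 \<le> m" "m \<le> n" for m n
      using that(2,1) by (induction rule: dec_induct) (auto intro: order_trans N0(1))
    define bad where "bad N = {z. \<exists>m\<ge>N. s m * dist ((T ^^ m) z) y < a}" for N
    have Tn [measurable]: "(T ^^ n) \<in> borel_measurable M" for n
      using funpow_measurable[OF invariant_probD(3)[OF inv]]
        measurable_cong_sets[OF refl invariant_probD(2)[OF inv]] by blast
    have bad: "bad N \<in> sets M" for N
    proof -
      have "{z \<in> space M. \<exists>m\<ge>N. s m * dist ((T ^^ m) z) y < a} \<in> sets M" by measurable
      then show ?thesis by (simp add: bad_def sp)
    qed
    have "decseq bad" unfolding decseq_def bad_def by (auto intro: order_trans)
    then have "(\<lambda>N. measure M (bad N)) \<longlonglongrightarrow> measure M (\<Inter>N. bad N)"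
      by (intro finite_Lim_measure_decseq) (use bad in auto)
    moreover have "measure M (\<Inter>N. bad N) = 0"
    proof -
      have "AE x in M. x \<notin> (\<Inter>N. bad N)"
        using ae
      proof eventually_elim
        case (elim x)
        then have "ereal a < liminf (\<lambda>n. ereal (s n * dist ((T ^^ n) x) y))"
          using ag by (simp add: scaled_liminf_def)
        from less_LiminfD[OF this] obtain N where "\<And>n. n \<ge> N \<Longrightarrow> a < s n * dist ((T ^^ n) x) y"
          by (auto simp: eventually_sequentially)
        then have "x \<notin> bad N" unfolding bad_def by force
        then show ?case by blast
      qed
      then show ?thesis using prob_eq_0[of "\<Inter>N. bad N"] bad by blast
    qed
    ultimately have "\<forall>\<^sub>F N in sequentially. measure M (bad N) < 1 / 8"
      by (intro order_tendstoD(2)[where y = 0]) auto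
    then obtain N where N: "N \<ge> N0" "measure M (bad N) < 1 / 8"
      unfolding eventually_sequentially by (meson nat_le_linear order_trans)
    have "1 / 8 \<le> measure M (bad N)"
    proof (rule maximal_ergodic_frequency[OF inv bad])
      show "AE x in M. \<exists>n. 1 / 8 * real n < (\<Sum>i<n. indicator (bad N) ((T ^^ i) x))"
        using ae
      proof eventually_elim
        case (elim x)
        then have "\<exists>\<^sub>F n in sequentially. s n * dist ((T ^^ n) x) y < b"
          using b(1) by (intro frequently_of_scaled_liminf_less) simp
        \<comment> \<open>The window \<open>?I\<close> has \<open>n div 2 - N\<close> elements. With
          \<open>N\<close> at most \<open>n / 8 - 1\<close> this exceeds \<open>n / 8\<close>, the
          frequency to be contradicted.\<close>
        then obtain n where n: "n \<ge> 8 * N + 8" "s n * dist ((T ^^ n) x) y < b"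
          by (meson frequently_sequentially)
        let ?I = "{n - n div 2..<n - N}"
        have in_bad: "(T ^^ i) x \<in> bad N" if i: "i \<in> ?I" for i
        proof -
          define m where "m = n - i"
          have m: "m \<ge> N" "2 * m \<le> n" "m + i = n" using i n(1) by (auto simp: m_def)
          \<comment> \<open>The lower end of \<open>?I\<close> gives \<open>2 * m \<le> n\<close>
            and the upper end \<open>m \<ge> N \<ge> N0\<close>. Hence
            \<open>l * s m \<le> s (2 * m) \<le> s n\<close>: halving the remaining time gains the
            factor \<open>l\<close>, enough to pass from \<open>b\<close> to
            \<open>a\<close>.\<close>
          have "l * s m \<le> s n" using N0(2)[of m] mono[of "2 * m" n] m N(1) by auto
          then have "l * (s m * dist ((T ^^ n) x) y) \<le> s n * dist ((T ^^ n) x) y"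
            by (simp add: mult.assoc[symmetric] mult_right_mono)
          also have "\<dots> < l * a" using n(2) b(2) by linarith
          finally have "s m * dist ((T ^^ n) x) y < a" using l(1) by simp
          moreover have "(T ^^ n) x = (T ^^ m) ((T ^^ i) x)"
            by (simp flip: m(3) add: funpow_add)
          ultimately show ?thesis using m(1) unfolding bad_def by auto
        qed
        have "real n / 8 < real (card ?I)" using n(1) by simp
        also have "\<dots> = (\<Sum>i\<in>?I. indicator (bad N) ((T ^^ i) x))" using in_bad by simp
        also have "\<dots> \<le> (\<Sum>i<n. indicator (bad N) ((T ^^ i) x))"
          by (rule sum_mono2) auto
        finally show ?case by (intro exI[of _ n]) simp
      qed
    qed
    with N(2) show ?thesis by simp
  qed (use g' in auto)
qed

section \<open>From fixed targets to the product measure\<close>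

theorem theorem6p7:
  fixes T :: "'a::{metric_space, second_countable_topology} \<Rightarrow> 'a"
    and \<mu> \<nu> :: "'a measure"
    and s :: "nat \<Rightarrow> real"
  assumes "T \<in> borel_measurable borel"
    and "invariant_prob T \<mu>" and "ergodic T \<mu>"
    and "invariant_prob T \<nu>" and "ergodic T \<nu>"
    and "locally_lipschitz_mod T \<nu>"
    and "nice_scale s"
  shows "(AE p in \<mu> \<Otimes>\<^sub>M \<nu>. liminf (\<lambda>n. ereal (s n * dist ((T ^^ n) (fst p)) (snd p))) = 0)
       \<or> (AE p in \<mu> \<Otimes>\<^sub>M \<nu>. liminf (\<lambda>n. ereal (s n * dist ((T ^^ n) (fst p)) (snd p))) = \<infinity>)"
proof -
  interpret M: prob_space \<mu> by (rule invariant_probD(1)[OF assms(2)])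
  interpret N: prob_space \<nu> by (rule invariant_probD(1)[OF assms(4)])
  interpret pair_sigma_finite \<mu> \<nu> ..
  let ?f = "scaled_liminf T s"
  have sp: "space \<mu> = UNIV" "space \<nu> = UNIV" using invariant_probD(5) assms(2,4) by auto
  note meas [measurable] = scaled_liminf_pair_measurable[OF assms(1)
      invariant_probD(2)[OF assms(2)] invariant_probD(2)[OF assms(4)], of s]
  have level: "{p. ?f (fst p) (snd p) = c} \<in> sets (\<mu> \<Otimes>\<^sub>M \<nu>)" for c
  proof -
    have "{p \<in> space (\<mu> \<Otimes>\<^sub>M \<nu>). ?f (fst p) (snd p) = c} \<in> sets (\<mu> \<Otimes>\<^sub>M \<nu>)" by measurable
    then show ?thesis by (simp add: space_pair_measure sp)
  qed
  have fubini: "AE p in \<mu> \<Otimes>\<^sub>M \<nu>. ?f (fst p) (snd p) = c"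
    if "AE y in \<nu>. AE x in \<mu>. ?f x y = c" for c
  proof (rule AE_pair_measure)
    show "{p \<in> space (\<mu> \<Otimes>\<^sub>M \<nu>). ?f (fst p) (snd p) = c} \<in> sets (\<mu> \<Otimes>\<^sub>M \<nu>)" by measurable
    \<comment> \<open>The hypothesis has the target outermost; measurability of the level set allows
      the two quantifiers to be exchanged.\<close>
    have "AE x in \<mu>. AE y in \<nu>. ?f x y = c"
      using that AE_commute[of "\<lambda>x y. ?f x y = c"] level[of c]
      by (simp add: space_pair_measure sp case_prod_beta)
    then show "AE x in \<mu>. AE y in \<nu>. ?f (fst (x, y)) (snd (x, y)) = c" by simp
  qed
  define A where "A = {y. AE x in \<mu>. ?f x y = 0}"
  have A: "A \<in> sets \<nu>"
  proof -
    let ?Q = "{p. ?f (fst p) (snd p) = 0}"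
    have Q: "{x. ?f x y = 0} \<in> sets \<mu>" for y
      using sets_Pair2[OF level[of 0], of y] by (simp add: vimage_def)
    \<comment> \<open>Membership in \<open>A\<close> means that a section of \<open>?Q\<close> has
      measure 1, and the measure of sections is a measurable function of \<open>y\<close>.\<close>
    have "(\<lambda>y. emeasure \<mu> ((\<lambda>x. (x, y)) -` ?Q)) \<in> borel_measurable \<nu>"
      by (rule measurable_emeasure_Pair2[OF level])
    then have "{y \<in> space \<nu>. emeasure \<mu> ((\<lambda>x. (x, y)) -` ?Q) = 1} \<in> sets \<nu>" by measurable
    moreover have "A = {y \<in> space \<nu>. emeasure \<mu> ((\<lambda>x. (x, y)) -` ?Q) = 1}"
      unfolding A_def using M.prob_eq_1[OF Q] by (auto simp: sp vimage_def M.emeasure_eq_measure)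
    ultimately show ?thesis by simp
  qed
  have "AE y in \<nu>. y \<in> A \<longrightarrow> T y \<in> A"
    using assms(6) unfolding locally_lipschitz_mod_def
  proof eventually_elim
    case (elim y)
    then show ?case
      using scaled_liminf_zero_image[OF assms(7) elim] by (auto simp: A_def elim: eventually_mono)
  qed
  from ergodic_subinvariant[OF assms(4,5) A this]
  show ?thesis
  proof
    assume "AE y in \<nu>. y \<in> A"
    then show ?thesis using fubini[of 0] by (simp add: A_def scaled_liminf_def)
  next
    assume "AE y in \<nu>. y \<notin> A"
    \<comment> \<open>Off \<open>A\<close> the zero alternative fails, so the law for a fixed target
      leaves only infinity.\<close>
    then have "AE y in \<nu>. AE x in \<mu>. ?f x y = \<infinity>"
      by eventually_elim (use scaled_liminf_zero_or_infinite[OF assms(2,3,7)] in \<open>auto simp: A_def\<close>)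
    then show ?thesis using fubini[of \<infinity>] by (simp add: scaled_liminf_def)
  qed
qed

end
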